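(* Let $\mu \in \mathbb{R}$, $\sigma^2 > 0$, let $q(w)$ be the density of $\mathcal{N}(\mu,\sigma^2)$ on $\mathbb{R}$, let $p(w) = C/|w|$ with a constant $C \in (0,\infty)$, and set $u := \mu^2/(2\sigma^2) \ge 0$. Then $$\mathrm{KL}(q(w)\,\|\,p(w)) = -\tfrac12 \log(2\pi e) - \log C + \tfrac12\left(\log 2 + e^{-u}\sum_{k=0}^{\infty} \frac{u^k}{k!}\,\psi(1/2+k)\right)$$ $$= -\tfrac12\log(\pi e) - \log C - \tfrac12\left(\left.\frac{\partial}{\partial a} M(a;1/2;-u)\right|_{a=0} + \gamma + 2\log 2\right).$$ Moreover, viewed as a function of $u \in [0,\infty)$ (it depends on $(\mu,\sigma^2)$ only through $u$), $\mathrm{KL}(q(w)\,\|\,p(w))$ is differentiable (one-sidedly at $u=0$) with $$\nabla_u \mathrm{KL}(q(w)\,\|\,p(w)) = \begin{cases} 1 & u = 0,\\[2pt] \dfrac{D_+(\sqrt{u})}{\sqrt{u}} & u > 0,\end{cases}$$ this derivative is continuous in $u$ on $[0,\infty)$, and the gradients with respect to $\mu$ and $\sigma^2$ are obtained from it by the chain rule, i.e. $\frac{\partial}{\partial \mu}\mathrm{KL} = \nabla_u \mathrm{KL}\cdot\frac{\partial u}{\partial \mu}$ and $\frac{\partial}{\partial \sigma^2}\mathrm{KL} = \nabla_u \mathrm{KL}\cdot\frac{\partial u}{\partial \sigma^2}$.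
   Context: Here $p$ is a non-normalisable density, and $\mathrm{KL}(q(w)\,\|\,p(w)) := \mathbb{E}_{w\sim q}[\log q(w)] - \mathbb{E}_{w \sim q}[\log p(w)]$ (a "pseudo" KL divergence). $\psi$ is the digamma function $\psi(x) = \Gamma'(x)/\Gamma(x)$; $\gamma$ is the Euler–Mascheroni constant; $M(a;b;z) = \sum_{n=0}^{\infty} \frac{(a)_n}{(b)_n}\frac{z^n}{n!}$, with $(a)_n = a(a+1)\cdots(a+n-1)$ and $(a)_0 = 1$, is Kummer's function of the first kind; $D_+(x) = e^{-x^2}\int_0^x e^{t^2}\,dt$ is the Dawson integral. The convention $0^0 := 1$ is used in the power series. *)

theory Defs
  imports "HOL-Probability.Probability"
begin

text \<open>Pseudo Kullback--Leibler divergence of a probability density \<open>q\<close> relative to a possibly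
  non-normalisable density \<open>p\<close>, both with respect to Lebesgue measure.  It is meaningful when
  both expectations exist, i.e. when \<open>has_pseudo_KL q p\<close> holds.\<close>

definition has_pseudo_KL :: "(real \<Rightarrow> real) \<Rightarrow> (real \<Rightarrow> real) \<Rightarrow> bool" where
  "has_pseudo_KL q p \<longleftrightarrow>
     integrable (density lborel q) (\<lambda>w. ln (q w)) \<and>
     integrable (density lborel q) (\<lambda>w. ln (p w))"

definition pseudo_KL :: "(real \<Rightarrow> real) \<Rightarrow> (real \<Rightarrow> real) \<Rightarrow> real" where
  "pseudo_KL q p =
     (LINT w|density lborel q. ln (q w)) - (LINT w|density lborel q. ln (p w))"

text \<open>The value at \<open>w = 0\<close> is \<open>0\<close> by the convention on division; this is a null set.\<close>

definition log_uniform_density :: "real \<Rightarrow> real \<Rightarrow> real" where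
  "log_uniform_density C w = C / \<bar>w\<bar>"

text \<open>The second parameter \<open>v\<close> is the variance, whereas \<^const>\<open>normal_density\<close> takes the
  standard deviation.\<close>

definition KL_normal :: "real \<Rightarrow> real \<Rightarrow> real \<Rightarrow> real" where
  "KL_normal C \<mu> v = pseudo_KL (normal_density \<mu> (sqrt v)) (log_uniform_density C)"

definition u_of :: "real \<Rightarrow> real \<Rightarrow> real" where
  "u_of \<mu> v = \<mu>\<^sup>2 / (2 * v)"

definition kummer_M :: "real \<Rightarrow> real \<Rightarrow> real \<Rightarrow> real" where
  "kummer_M a b z = (\<Sum>n. pochhammer a n / pochhammer b n * (z ^ n / fact n))"

definition dawson :: "real \<Rightarrow> real" where
  "dawson x = exp (- x\<^sup>2) * (LBINT t=0..ereal x. exp (t\<^sup>2))"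

end

(* The moments E[Z^(2k) ln|Z|] of a standard normal variable reduce, via t = z^2/2, to Gamma'(k + 1/2),
   which is the Gamma integral with an extra factor ln t. Expanding the density of N(m,1) against that
   of N(0,1) gives an even part cosh(m z); integrating its power series term by term yields E[ln|w|] as
   a Poisson(u) average of (ln 2 + psi(k + 1/2))/2.

   Multiplying the series by exp(-u) turns its coefficients into forward differences of psi at 1/2, which
   telescope (psi(x+1) - psi(x) = 1/x) to factorials over Pochhammer symbols: these are the coefficients
   of the a-derivative of Kummer's function. Differentiating in u takes one difference of psi, which
   leaves exp(-u) times the sum of u^n / (n! (n + 1/2)), the power series of Dawson's integral. *)

theory Submission
  imports Defs
begin

section \<open>Logarithmic Gamma integrals\<close>

lemma has_integral_Gamma_pos:
  fixes s :: real
  assumes "s > 0"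
  shows "((\<lambda>t. t powr (s - 1) / exp t) has_integral Gamma s) {0<..}"
proof -
  have "((\<lambda>t. t powr (s - 1) / exp t) has_integral Gamma s) {0..} \<longleftrightarrow>
      ((\<lambda>t. t powr (s - 1) / exp t) has_integral Gamma s) {0<..}"
    by (rule has_integral_spike_set_eq; rule negligible_subset[of "{0}"]) auto
  with Gamma_integral_real[OF assms] show ?thesis by simp
qed

text \<open>Mean value bound: the slope of exp between 0 and y is at most
  \<open>max 1 (exp y)\<close>. It controls difference quotients of \<open>t powr s\<close> in s
  uniformly in the step.\<close>

lemma abs_exp_minus_one_le:
  fixes y :: real
  shows "\<bar>exp y - 1\<bar> \<le> \<bar>y\<bar> * max 1 (exp y)"
proof (cases "y \<ge> 0")
  case True
  have "exp y * (1 - y) \<le> exp y * exp (- y)"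
    using exp_ge_add_one_self[of "-y"] by (intro mult_left_mono) auto
  then have "exp y - 1 \<le> y * exp y" by (simp add: algebra_simps exp_minus_inverse)
  with True show ?thesis by simp
next
  case False
  moreover have "1 - exp y \<le> - y" using exp_ge_add_one_self[of y] by linarith
  ultimately show ?thesis by simp
qed

text \<open>The bound ln s <= s - 1 handles large t at s = t and small t at s =
  \<open>t powr (- e)\<close>; the small negative power stays integrable against the Gamma
  weight.\<close>

lemma abs_ln_le_powr:
  fixes t e :: real
  assumes "t > 0" "e > 0"
  shows "\<bar>ln t\<bar> \<le> t + t powr (- e) / e"
proof -
  have 1: "ln t \<le> t" using ln_le_minus_one[of t] assms by simp
  have "- e * ln t = ln (t powr (-e))" using assms by (simp add: ln_powr)
  also have "\<dots> \<le> t powr (-e)" using ln_le_minus_one[of "t powr (-e)"] assms by simp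
  finally have "- ln t \<le> t powr (- e) / e" using assms by (simp add: field_simps)
  moreover have "0 \<le> t powr (- e) / e" using assms by simp
  ultimately show ?thesis using 1 assms by linarith
qed

text \<open>Differentiation of the Gamma integral in its parameter, along the steps 1/(n+1) and by
  dominated convergence. Absolute integrability is recorded for the later change of
  variables.\<close>

lemma Gamma_log_integral:
  fixes x :: real
  assumes x: "x > 0"
  shows "(\<lambda>t. t powr (x - 1) / exp t * ln t) absolutely_integrable_on {0<..}"
    and "((\<lambda>t. t powr (x - 1) / exp t * ln t) has_integral (Gamma x * Digamma x)) {0<..}"
proof -
  define g where "g = (\<lambda>t::real. t powr (x - 1) / exp t * ln t)"
  define h where "h = (\<lambda>n. inverse (real (Suc n)))"
  \<comment> \<open>The product t^(x-1) exp(-t) (t + t^(-x/2) / (x/2)) (1 + t), expanded into Gamma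
    integrands with positive parameters x+1, x+2, x/2 and x/2+1.\<close>
  define B where "B = (\<lambda>t::real. t powr (x + 1 - 1) / exp t + t powr (x + 2 - 1) / exp t
      + 2 / x * (t powr (x/2 - 1) / exp t) + 2 / x * (t powr (x/2 + 1 - 1) / exp t))"
  define f where "f = (\<lambda>n t. (t powr (x + h n - 1) / exp t - t powr (x - 1) / exp t) / h n)"
  have h: "h n > 0" "h n \<le> 1" for n by (auto simp: h_def divide_simps)
  have Bint: "B integrable_on {0<..}"
    unfolding B_def using x
    by (intro integrable_add integrable_on_mult_right has_integral_integrable[OF has_integral_Gamma_pos]) auto
  have B_eq: "B t = t powr (x - 1) / exp t * ((t + t powr (- (x/2)) / (x/2)) * (1 + t))" if "t > 0" for t
  proof -
    have "t powr (x + 1 - 1) = t powr (x - 1) * t" "t powr (x + 2 - 1) = t powr (x - 1) * (t * t)"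
      "t powr (x / 2 - 1) = t powr (x - 1) * t powr (- (x/2))"
      "t powr (x / 2 + 1 - 1) = t powr (x - 1) * (t powr (- (x/2)) * t)"
      using that powr_add[of t "x - 1" 1] powr_add[of t "x - 1" 2] powr_add[of t "x - 1" "- (x/2)"]
        powr_add[of t "x/2 - 1" 1]
      by (simp_all add: powr_numeral power2_eq_square algebra_simps)
    then show ?thesis unfolding B_def using x by (simp add: field_simps)
  qed
  have ln_bd: "\<bar>ln t\<bar> \<le> t + t powr (- (x/2)) / (x/2)" if "t > 0" for t
    using abs_ln_le_powr[of t "x/2"] that x by simp
  have fb: "norm (f n t) \<le> B t" if t: "t > 0" for n t
  proof -
    have "t powr (x + h n - 1) = t powr (x - 1) * exp (h n * ln t)"
      using t by (simp add: powr_def exp_add[symmetric] algebra_simps)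
    then have "f n t = t powr (x - 1) / exp t * ((exp (h n * ln t) - 1) / h n)"
      by (simp add: f_def algebra_simps diff_divide_distrib)
    then have "norm (f n t) = t powr (x - 1) / exp t * (\<bar>exp (h n * ln t) - 1\<bar> / h n)"
      using h[of n] by (simp add: abs_mult)
    also have "\<dots> \<le> t powr (x - 1) / exp t * (\<bar>ln t\<bar> * (1 + t))"
    proof (rule mult_left_mono)
      \<comment> \<open>This is t to the power \<open>h n\<close> with 0 < h n <= 1: at most t when
        t >= 1, at most 1 otherwise.\<close>
      have "exp (h n * ln t) \<le> 1 + t"
      proof (cases "t \<ge> 1")
        case True
        then have "h n * ln t \<le> 1 * ln t" using h[of n] by (intro mult_right_mono) auto
        then have "exp (h n * ln t) \<le> exp (ln t)" by simp
        then show ?thesis using t by simp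
      next
        case False
        then have "h n * ln t \<le> 0" using h[of n] t by (simp add: mult_le_0_iff)
        then have "exp (h n * ln t) \<le> 1" by simp
        then show ?thesis using t by linarith
      qed
      then have "max 1 (exp (h n * ln t)) \<le> 1 + t" using t by simp
      then have "\<bar>h n * ln t\<bar> * max 1 (exp (h n * ln t)) \<le> \<bar>h n * ln t\<bar> * (1 + t)"
        by (intro mult_left_mono) auto
      with abs_exp_minus_one_le[of "h n * ln t"]
      have "\<bar>exp (h n * ln t) - 1\<bar> \<le> \<bar>h n * ln t\<bar> * (1 + t)"
        by (rule order_trans)
      also have "\<dots> = h n * (\<bar>ln t\<bar> * (1 + t))"
        using h[of n] by (simp add: abs_mult mult.assoc)
      finally have "\<bar>exp (h n * ln t) - 1\<bar> \<le> h n * (\<bar>ln t\<bar> * (1 + t))" .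
      then show "\<bar>exp (h n * ln t) - 1\<bar> / h n \<le> \<bar>ln t\<bar> * (1 + t)"
        using h[of n] by (simp add: field_simps)
    qed simp
    also have "\<dots> \<le> B t"
      unfolding B_eq[OF t] using t by (intro mult_left_mono mult_right_mono ln_bd) auto
    finally show ?thesis .
  qed
  have gb: "norm (g t) \<le> B t" if t: "t > 0" for t
  proof -
    have "norm (g t) = t powr (x - 1) / exp t * \<bar>ln t\<bar>" by (simp add: g_def abs_mult)
    also have "\<dots> \<le> t powr (x - 1) / exp t * ((t + t powr (- (x/2)) / (x/2)) * (1 + t))"
    proof (rule mult_left_mono)
      have "\<bar>ln t\<bar> \<le> \<bar>ln t\<bar> * (1 + t)" using t by (simp add: algebra_simps)
      also have "\<dots> \<le> (t + t powr (- (x/2)) / (x/2)) * (1 + t)"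
        using t by (intro mult_right_mono ln_bd) auto
      finally show "\<bar>ln t\<bar> \<le> (t + t powr (- (x/2)) / (x/2)) * (1 + t)" .
    qed simp
    finally show ?thesis using B_eq[OF t] by simp
  qed
  \<comment> \<open>Composition with h turns the derivative limits at 0 into the sequential limits
    that dominated convergence works with.\<close>
  have hlim: "filterlim h (at 0) sequentially"
    unfolding filterlim_at using h LIMSEQ_inverse_real_of_nat
    by (auto simp: h_def)
  have *: "(g has_integral (Gamma x * Digamma x)) {0<..}"
  proof (rule has_integral_dominated_convergence[OF _ Bint])
    show "(f n has_integral ((Gamma (x + h n) - Gamma x) / h n)) {0<..}" for n
      unfolding f_def using x h[of n]
      by (intro has_integral_divide has_integral_diff has_integral_Gamma_pos) auto
    show "\<forall>t\<in>{0<..}. norm (f n t) \<le> B t" for n using fb by simp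
    show "\<forall>t\<in>{0<..}. (\<lambda>n. f n t) \<longlonglongrightarrow> g t"
    proof
      fix t :: real assume "t \<in> {0<..}"
      then have t: "t > 0" by simp
      have "((\<lambda>s. t powr (s - 1) / exp t) has_field_derivative g t) (at x)"
        using t by (auto intro!: derivative_eq_intros simp: g_def powr_def)
      then have "((\<lambda>y. (t powr (x + y - 1) / exp t - t powr (x - 1) / exp t) / y) \<longlongrightarrow> g t) (at 0)"
        by (simp add: DERIV_def)
      from filterlim_compose[OF this hlim] show "(\<lambda>n. f n t) \<longlonglongrightarrow> g t"
        by (simp add: f_def)
    qed
    have "x \<notin> \<int>\<^sub>\<le>\<^sub>0" using x by (auto elim!: nonpos_Ints_cases)
    then have "(Gamma has_field_derivative Gamma x * Digamma x) (at x)"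
      by (rule has_field_derivative_Gamma)
    then have "((\<lambda>y. (Gamma (x + y) - Gamma x) / y) \<longlongrightarrow> Gamma x * Digamma x) (at 0)"
      by (simp add: DERIV_def)
    from filterlim_compose[OF this hlim]
    show "(\<lambda>n. (Gamma (x + h n) - Gamma x) / h n) \<longlonglongrightarrow> Gamma x * Digamma x" .
  qed
  then show "((\<lambda>t. t powr (x - 1) / exp t * ln t) has_integral (Gamma x * Digamma x)) {0<..}"
    by (simp add: g_def)
  have "g absolutely_integrable_on {0<..}"
    by (rule absolutely_integrable_integrable_bound[OF _ has_integral_integrable[OF *] Bint])
      (use gb in auto)
  then show "(\<lambda>t. t powr (x - 1) / exp t * ln t) absolutely_integrable_on {0<..}"
    by (simp add: g_def)
qed

section \<open>The logarithm of a normal variable\<close>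

text \<open>Substituting t = z^2/2 on the half-line gives Gamma integrals at k + 1/2, and evenness
  doubles the result. The factor 2^k (1/2)_k is the plain moment E[Z^(2k)].\<close>

lemma has_bochner_integral_log_moment:
  "has_bochner_integral lborel (\<lambda>z. std_normal_density z * (z ^ (2 * k) * ln \<bar>z\<bar>))
     (2 ^ k * pochhammer (1/2) k * (ln 2 + Digamma (1 / 2 + real k)) / 2)"
proof -
  define x where "x = 1/2 + real k"
  have x: "x > 0" by (simp add: x_def)
  \<comment> \<open>The Gamma integrand times ln(2 t); since 2 t = z^2, the logarithm becomes 2 ln
    z.\<close>
  define f where "f = (\<lambda>t. t powr (x - 1) / exp t * ln t + ln 2 * (t powr (x - 1) / exp t))"
  define h where "h = (\<lambda>z. std_normal_density z * (z ^ (2 * k) * ln \<bar>z\<bar>))"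
  define I where "I = Gamma x * Digamma x + ln 2 * Gamma x"
  have G: "(\<lambda>t. t powr (x - 1) / exp t) absolutely_integrable_on {0<..}"
    by (rule nonnegative_absolutely_integrable_1[OF has_integral_integrable[OF has_integral_Gamma_pos[OF x]]]) auto
  have f_abs: "f absolutely_integrable_on {0<..}"
    unfolding f_def
    by (intro set_integral_add Gamma_log_integral(1) x set_integrable_mult_right G)
  have f_int: "integral {0<..} f = I"
    unfolding f_def I_def
    by (intro integral_unique has_integral_add has_integral_mult_right Gamma_log_integral(2) x has_integral_Gamma_pos)
  have img: "(\<lambda>z::real. z\<^sup>2 / 2) ` {0<..} = {0<..}"
  proof (intro equalityI subsetI)
    fix t :: real assume "t \<in> {0<..}"
    then show "t \<in> (\<lambda>z::real. z\<^sup>2 / 2) ` {0<..}"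
      by (intro image_eqI[of _ _ "sqrt (2 * t)"]) auto
  qed auto
  have "(\<lambda>z. \<bar>z\<bar> * f (z\<^sup>2 / 2)) absolutely_integrable_on {0<..} \<and>
      integral {0<..} (\<lambda>z. \<bar>z\<bar> * f (z\<^sup>2 / 2)) = I"
  proof (subst has_absolute_integral_change_of_variables_1'[where g = "\<lambda>z. z\<^sup>2 / 2" and f = f])
    show "inj_on (\<lambda>z::real. z\<^sup>2 / 2) {0<..}" by (rule inj_onI) (auto simp: power2_eq_iff)
    show "((\<lambda>z. z\<^sup>2 / 2) has_field_derivative z) (at z within {0<..})" for z :: real
      by (auto intro!: derivative_eq_intros)
  qed (use f_abs f_int img in auto)
  \<comment> \<open>The constant undoes 1/2^k and sqrt 2 from the power of z^2/2 and the 2 from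
    ln(z^2), and restores the normalisation of the normal density.\<close>
  moreover define c where "c = 2 ^ k / (2 * sqrt 2) / sqrt (2 * pi)"
  have h_eq: "h z = c * (\<bar>z\<bar> * f (z\<^sup>2 / 2))" if "z \<in> {0<..}" for z
  proof -
    have z: "z > 0" using that by simp
    have "(z\<^sup>2 / 2) powr (x - 1) = (z\<^sup>2 / 2) powr real k / (z\<^sup>2 / 2) powr (1/2)"
      unfolding x_def by (simp add: powr_diff[symmetric])
    also have "\<dots> = (z\<^sup>2 / 2) ^ k / (z / sqrt 2)"
      using z by (simp add: powr_realpow powr_half_sqrt real_sqrt_divide)
    finally have p: "(z\<^sup>2 / 2) powr (x - 1) = z ^ (2 * k) / 2 ^ k * sqrt 2 / z"
      by (simp add: power_divide power_mult)
    have l: "ln (z\<^sup>2 / 2) = 2 * ln z - ln 2" using z by (simp add: ln_div ln_realpow)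
    have "f (z\<^sup>2 / 2) = z ^ (2 * k) / 2 ^ k * sqrt 2 / z * exp (- z\<^sup>2 / 2) * (2 * ln z)"
    proof -
      have "A / E * (2 * L - l) + l * (A / E) = A * (1 / E) * (2 * L)" for A E L l :: real
        by (simp add: diff_divide_distrib right_diff_distrib)
      moreover have "exp (- z\<^sup>2 / 2) = 1 / exp (z\<^sup>2 / 2)"
        by (simp add: exp_minus inverse_eq_divide)
      ultimately show ?thesis unfolding f_def p l by metis
    qed
    then show ?thesis
      using z by (simp add: h_def c_def std_normal_density_def field_simps)
  qed
  ultimately have "(\<lambda>z. c * (\<bar>z\<bar> * f (z\<^sup>2 / 2))) absolutely_integrable_on {0<..}"
      "integral {0<..} (\<lambda>z. c * (\<bar>z\<bar> * f (z\<^sup>2 / 2))) = c * I"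
    by (simp_all only: set_integrable_mult_right integral_mult_right)
  then have h: "h absolutely_integrable_on {0<..}" "integral {0<..} h = c * I"
    using h_eq set_integrable_cong[of lebesgue lebesgue "{0<..}" "{0<..}" h "\<lambda>z. c * (\<bar>z\<bar> * f (z\<^sup>2 / 2))"]
      integral_cong[of "{0<..}" h "\<lambda>z. c * (\<bar>z\<bar> * f (z\<^sup>2 / 2))"] by simp_all
  \<comment> \<open>The substitution gives integrals for the completed measure; Borel measurability
    carries them over to \<open>lborel\<close>.\<close>
  have meas: "(\<lambda>z. indicator {0<..} z *\<^sub>R h z) \<in> borel_measurable lborel"
    unfolding h_def by measurable
  have "has_bochner_integral lborel (\<lambda>z. indicator {0<..} z *\<^sub>R h z) (c * I)"
    using h(1) set_lebesgue_integral_eq_integral(2)[OF h(1)] h(2)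
    unfolding has_bochner_integral_iff set_integrable_def set_lebesgue_integral_def
      integrable_completion[OF meas] integral_completion[OF meas] by simp
  \<comment> \<open>The rule for even functions takes the closed half-line. The two agree because
    \<open>ln 0 = 0\<close> makes h vanish at 0, even for k = 0.\<close>
  also have "(\<lambda>z. indicator {0<..} z *\<^sub>R h z) = (\<lambda>z. indicator {0..} z *\<^sub>R h z)"
    by (auto simp: fun_eq_iff h_def indicator_def)
  finally have "has_bochner_integral lborel h (2 *\<^sub>R (c * I))"
    by (rule has_bochner_integral_even_function) (simp add: h_def std_normal_density_def)
  moreover have "2 *\<^sub>R (c * I) = 2 ^ k * pochhammer (1/2) k * (ln 2 + Digamma (1 / 2 + real k)) / 2"
  proof -
    have "(1/2::real) \<notin> \<int>\<^sub>\<le>\<^sub>0" by (auto elim!: nonpos_Ints_cases)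
    then have "Gamma x = sqrt pi * pochhammer (1/2) k"
      by (subst pochhammer_Gamma) (simp_all add: x_def Gamma_one_half_real)
    then show ?thesis by (simp add: I_def c_def x_def real_sqrt_mult field_simps)
  qed
  ultimately show ?thesis by (simp only: h_def)
qed

text \<open>Supplies the majorant for the expansion in m, where half of the Gaussian exponent is
  spent on exp |m z|. Scaling by sqrt 2 reduces it to the log moment with k = 0.\<close>

lemma integrable_exp_quarter_ln: "integrable lborel (\<lambda>z::real. exp (- z\<^sup>2 / 4) * ln \<bar>z\<bar>)"
proof -
  have "has_bochner_integral lborel (\<lambda>z::real. std_normal_density z * z ^ (2 * 0)) (fact (2 * 0) / (2 ^ 0 * fact 0))"
    by (rule std_normal_moment_even)
  then have "integrable lborel std_normal_density" by (simp add: has_bochner_integral_iff)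
  moreover have "integrable lborel (\<lambda>z. std_normal_density z * ln \<bar>z\<bar>)"
    using has_bochner_integral_log_moment[of 0] by (simp add: has_bochner_integral_iff)
  ultimately have "integrable lborel (\<lambda>z. sqrt (2 * pi) * (std_normal_density z * ln \<bar>z\<bar> + std_normal_density z * ln (sqrt 2)))"
    by simp
  then have "integrable lborel (\<lambda>z. exp (- (sqrt 2 * z)\<^sup>2 / 4) * ln \<bar>sqrt 2 * z\<bar>)"
  proof (rule integrable_cong_AE_imp)
    show "AE z in lborel. sqrt (2 * pi) * (std_normal_density z * ln \<bar>z\<bar> + std_normal_density z * ln (sqrt 2))
      = exp (- (sqrt 2 * z)\<^sup>2 / 4) * ln \<bar>sqrt 2 * z\<bar>"
      using AE_lborel_singleton[of "0::real"]
      by eventually_elim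
        (simp add: std_normal_density_def abs_mult ln_mult power_mult_distrib distrib_left add_ac)
  qed simp
  then show ?thesis
    using lborel_integrable_real_affine_iff[of "sqrt 2" "\<lambda>z. exp (- z\<^sup>2 / 4) * ln \<bar>z\<bar>" 0] by simp
qed

lemma cosh_even_series: "(\<lambda>k. x ^ (2 * k) / fact (2 * k)) sums cosh (x::real)"
proof -
  have "(\<lambda>n. if even n then x ^ n /\<^sub>R fact n else 0) sums cosh x"
    by (rule cosh_converges)
  then have "(\<lambda>k. (\<lambda>n. if even n then x ^ n /\<^sub>R fact n else 0) (2 * k)) sums cosh x"
    by (subst sums_mono_reindex) (auto simp: strict_mono_def elim!: evenE)
  then show ?thesis by (simp add: field_simps)
qed

text \<open>The density of N(m,1) is exp(-u) exp(m z) times the standard one. As ln |z| is even,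
  only cosh(m z) survives, and dominated convergence of its partial sums reduces the integral to log
  moments.\<close>

lemma has_bochner_integral_log_normal_unit_variance:
  fixes m :: real
  defines "u \<equiv> m\<^sup>2 / 2"
  shows "has_bochner_integral lborel (\<lambda>z. normal_density m 1 z * ln \<bar>z\<bar>)
     (exp (- u) * (\<Sum>k. u ^ k / fact k * (ln 2 + Digamma (1 / 2 + real k))) / 2)"
proof -
  define d where "d = (\<lambda>k. u ^ k / fact k * (ln 2 + Digamma (1 / 2 + real k)))"
  \<comment> \<open>The majorant comes from |m z| <= m^2 + z^2/4, that is, from (|m| - |z|/2)^2 >=
    0.\<close>
  define w where "w = (\<lambda>z::real. exp (m\<^sup>2) / sqrt (2 * pi) * \<bar>exp (- z\<^sup>2 / 4) * ln \<bar>z\<bar>\<bar>)"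
  define s where "s = (\<lambda>n z. \<Sum>k<n. m ^ (2 * k) / fact (2 * k) * (std_normal_density z * (z ^ (2 * k) * ln \<bar>z\<bar>)))"
  define f where "f = (\<lambda>z. std_normal_density z * ln \<bar>z\<bar> * cosh (m * z))"
  have w_int: "integrable lborel w"
    unfolding w_def by (intro integrable_mult_right integrable_abs integrable_exp_quarter_ln)
  have exp_bound: "std_normal_density z * \<bar>ln \<bar>z\<bar>\<bar> * exp \<bar>m * z\<bar> \<le> w z" for z
  proof -
    have "0 \<le> (\<bar>m\<bar> - \<bar>z\<bar> / 2)\<^sup>2" by simp
    then have "\<bar>m * z\<bar> \<le> m\<^sup>2 + z\<^sup>2 / 4"
      by (simp add: power2_diff abs_mult power_divide)
    then have "- z\<^sup>2 / 2 + \<bar>m * z\<bar> \<le> m\<^sup>2 - z\<^sup>2 / 4" by simp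
    then have "exp (- z\<^sup>2 / 2) * exp \<bar>m * z\<bar> \<le> exp (m\<^sup>2) * exp (- z\<^sup>2 / 4)"
      by (simp add: exp_add[symmetric])
    then have "(exp (- z\<^sup>2 / 2) * exp \<bar>m * z\<bar>) * (\<bar>ln \<bar>z\<bar>\<bar> / sqrt (2 * pi))
        \<le> (exp (m\<^sup>2) * exp (- z\<^sup>2 / 4)) * (\<bar>ln \<bar>z\<bar>\<bar> / sqrt (2 * pi))"
      by (intro mult_right_mono) auto
    then show ?thesis by (simp add: w_def std_normal_density_def abs_mult mult_ac)
  qed
  have s_eq: "s n z = std_normal_density z * ln \<bar>z\<bar> * (\<Sum>k<n. (m * z) ^ (2 * k) / fact (2 * k))" for n z
    unfolding s_def by (simp add: sum_distrib_left power_mult_distrib mult_ac)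
  have s_meas: "s n \<in> borel_measurable lborel" for n unfolding s_def by measurable
  have f_meas: "f \<in> borel_measurable lborel"
    unfolding f_def cosh_def by measurable
  have s_lim: "(\<lambda>n. s n z) \<longlonglongrightarrow> f z" for z
    unfolding s_eq f_def using cosh_even_series[of "m * z"]
    by (intro tendsto_mult_left) (simp add: sums_def)
  have s_bound: "norm (s n z) \<le> w z" for n z
  proof -
    have "(\<Sum>k<n. (m * z) ^ (2 * k) / fact (2 * k)) \<le> cosh (m * z)"
      using sum_le_suminf[OF sums_summable[OF cosh_even_series[of "m * z"]], of "{..<n}"]
        sums_unique[OF cosh_even_series[of "m * z"]] by (simp add: power_mult)
    also have "\<dots> \<le> exp \<bar>m * z\<bar>"
    proof -
      have "exp (m * z) \<le> exp \<bar>m * z\<bar>" "exp (- (m * z)) \<le> exp \<bar>m * z\<bar>"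
        by (simp_all only: exp_le_cancel_iff)
      then show ?thesis unfolding cosh_def by (simp del: exp_le_cancel_iff)
    qed
    finally have *: "(\<Sum>k<n. (m * z) ^ (2 * k) / fact (2 * k)) \<le> exp \<bar>m * z\<bar>" .
    have "0 \<le> (\<Sum>k<n. (m * z) ^ (2 * k) / fact (2 * k))"
      by (intro sum_nonneg) (simp add: power_mult)
    then have "norm (s n z) = std_normal_density z * \<bar>ln \<bar>z\<bar>\<bar> * (\<Sum>k<n. (m * z) ^ (2 * k) / fact (2 * k))"
      by (simp add: s_eq abs_mult)
    also have "\<dots> \<le> std_normal_density z * \<bar>ln \<bar>z\<bar>\<bar> * exp \<bar>m * z\<bar>"
      using * by (intro mult_left_mono) auto
    also note exp_bound
    finally show ?thesis .
  qed
  have f_int: "integrable lborel f"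
    by (rule integrable_dominated_convergence[where s = s, OF f_meas s_meas w_int]) (simp_all add: s_lim s_bound del: real_norm_def)
  have lim: "(\<lambda>n. integral\<^sup>L lborel (s n)) \<longlonglongrightarrow> integral\<^sup>L lborel f"
    by (rule integral_dominated_convergence[where s = s, OF f_meas s_meas w_int]) (simp_all add: s_lim s_bound del: real_norm_def)
  have "integral\<^sup>L lborel (s n) = (\<Sum>k<n. d k / 2)" for n
  proof -
    have "has_bochner_integral lborel (s n) (\<Sum>k<n. m ^ (2 * k) / fact (2 * k) *
        (2 ^ k * pochhammer (1/2) k * (ln 2 + Digamma (1 / 2 + real k)) / 2))"
      unfolding s_def
      by (intro has_bochner_integral_sum has_bochner_integral_mult_right has_bochner_integral_log_moment)
    moreover have "m ^ (2 * k) / fact (2 * k) *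
        (2 ^ k * pochhammer (1/2) k * (ln 2 + Digamma (1 / 2 + real k)) / 2) = d k / 2" for k
    proof -
      have "pochhammer (1/2 :: real) k > 0" by (intro pochhammer_pos) simp
      \<comment> \<open>With m^(2k) = 2^k u^k, everything cancels except the weight u^k / k! and
        half of ln 2 + psi(k + 1/2).\<close>
      moreover have "fact (2 * k) = 2 ^ k * 2 ^ k * pochhammer (1/2 :: real) k * fact k"
        unfolding fact_double by (simp add: power_add mult_2)
      moreover have "m ^ (2 * k) = 2 ^ k * u ^ k"
        by (simp add: u_def power_divide power_mult)
      ultimately show ?thesis by (simp add: d_def)
    qed
    ultimately show ?thesis by (simp only: has_bochner_integral_integral_eq)
  qed
  with lim have "(\<lambda>k. d k / 2) sums integral\<^sup>L lborel f" by (simp add: sums_def)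
  then have d: "d sums (2 * integral\<^sup>L lborel f)" using sums_mult[of "\<lambda>k. d k / 2" _ 2] by simp
  have N_eq: "normal_density m 1 z = exp (- u) * (std_normal_density z * exp (m * z))" for z
    by (simp add: normal_density_def u_def exp_add[symmetric] power2_diff field_simps)
  define g where "g = (\<lambda>z. normal_density m 1 z * ln \<bar>z\<bar>)"
  have g_int: "integrable lborel g"
  proof (rule Bochner_Integration.integrable_bound[OF integrable_mult_right[OF w_int, of "exp (- u)"]])
    show "AE z in lborel. norm (g z) \<le> norm (exp (- u) * w z)"
    proof (rule AE_I2)
      fix z
      have "norm (g z) = exp (- u) * (std_normal_density z * \<bar>ln \<bar>z\<bar>\<bar> * exp (m * z))"
        by (simp add: g_def N_eq abs_mult)
      also have "\<dots> \<le> exp (- u) * (std_normal_density z * \<bar>ln \<bar>z\<bar>\<bar> * exp \<bar>m * z\<bar>)"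
        by (intro mult_left_mono) auto
      also have "\<dots> \<le> exp (- u) * w z" using exp_bound by (intro mult_left_mono) auto
      also have "\<dots> \<le> norm (exp (- u) * w z)" by simp
      finally show "norm (g z) \<le> norm (exp (- u) * w z)" .
    qed
  qed (simp add: g_def)
  define J where "J = integral\<^sup>L lborel g"
  have g1: "has_bochner_integral lborel g J"
    using g_int by (simp add: J_def has_bochner_integral_iff)
  \<comment> \<open>Reflection preserves Lebesgue measure, and adding g(-z) to g(z) extracts the
    even part of exp(m z).\<close>
  have g2: "has_bochner_integral lborel (\<lambda>z. g (- z)) J"
    using g1 lborel_has_bochner_integral_real_affine_iff[of "-1" g J 0] by simp
  have "(\<lambda>z. g z + g (- z)) = (\<lambda>z. 2 * exp (- u) * f z)"
    by (auto simp: fun_eq_iff g_def N_eq f_def cosh_def std_normal_density_def field_simps)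
  then have "has_bochner_integral lborel (\<lambda>z. 2 * exp (- u) * f z) (J + J)"
    using has_bochner_integral_add[OF g1 g2] by simp
  then have "J + J = 2 * exp (- u) * integral\<^sup>L lborel f"
    by (simp add: has_bochner_integral_iff)
  then have "J = exp (- u) * (\<Sum>k. d k) / 2" using d by (simp add: sums_iff)
  with g1 show "has_bochner_integral lborel (\<lambda>z. normal_density m 1 z * ln \<bar>z\<bar>)
     (exp (- u) * (\<Sum>k. u ^ k / fact k * (ln 2 + Digamma (1 / 2 + real k))) / 2)"
    by (simp add: g_def d_def)
qed

text \<open>The scaling w = \<sigma> z leads to unit variance and mean \<mu>/\<sigma>, with the same
  u. Off z = 0, ln |w| = ln \<sigma> + ln |z|, so ln \<sigma> is added once, weighted by total mass
  1.\<close>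

lemma has_bochner_integral_log_normal:
  fixes \<mu> \<sigma> :: real
  assumes \<sigma>: "\<sigma> > 0"
  defines "u \<equiv> \<mu>\<^sup>2 / (2 * \<sigma>\<^sup>2)"
  shows "has_bochner_integral lborel (\<lambda>w. normal_density \<mu> \<sigma> w * ln \<bar>w\<bar>)
     (ln \<sigma> + exp (- u) * (\<Sum>k. u ^ k / fact k * (ln 2 + Digamma (1 / 2 + real k))) / 2)"
proof -
  define L where "L = exp (- u) * (\<Sum>k. u ^ k / fact k * (ln 2 + Digamma (1 / 2 + real k))) / 2"
  have u: "u = (\<mu> / \<sigma>)\<^sup>2 / 2" by (simp add: u_def power_divide)
  have 1: "has_bochner_integral lborel (\<lambda>z. normal_density (\<mu> / \<sigma>) 1 z * ln \<bar>z\<bar>) L"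
    using has_bochner_integral_log_normal_unit_variance[of "\<mu> / \<sigma>"] by (simp add: L_def u)
  have 2: "has_bochner_integral lborel (normal_density (\<mu> / \<sigma>) 1) 1"
    by (simp add: has_bochner_integral_iff)
  have "has_bochner_integral lborel (\<lambda>z. (ln \<sigma> * normal_density (\<mu> / \<sigma>) 1 z + normal_density (\<mu> / \<sigma>) 1 z * ln \<bar>z\<bar>) / \<sigma>)
      ((ln \<sigma> * 1 + L) / \<sigma>)"
    using \<sigma> by (intro has_bochner_integral_divide has_bochner_integral_add has_bochner_integral_mult_right 1 2)
  moreover have "AE z in lborel. (ln \<sigma> * normal_density (\<mu> / \<sigma>) 1 z + normal_density (\<mu> / \<sigma>) 1 z * ln \<bar>z\<bar>) / \<sigma>
      = normal_density \<mu> \<sigma> (0 + \<sigma> * z) * ln \<bar>0 + \<sigma> * z\<bar>"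
    using AE_lborel_singleton[of "0::real"]
  proof eventually_elim
    case (elim z)
    have "normal_density \<mu> \<sigma> (\<sigma> * z) = normal_density (\<mu> / \<sigma>) 1 z / \<sigma>"
    proof -
      have "(\<sigma> * z - \<mu>)\<^sup>2 / (2 * \<sigma>\<^sup>2) = (z - \<mu> / \<sigma>)\<^sup>2 / 2"
        using \<sigma> by (simp add: power2_eq_square field_simps)
      then show ?thesis using \<sigma> by (simp add: normal_density_def real_sqrt_mult)
    qed
    with elim \<sigma> show ?case by (simp add: abs_mult ln_mult algebra_simps)
  qed
  ultimately have "has_bochner_integral lborel (\<lambda>z. normal_density \<mu> \<sigma> (0 + \<sigma> * z) * ln \<bar>0 + \<sigma> * z\<bar>) ((ln \<sigma> + L) / \<sigma>)"
    by (subst (asm) has_bochner_integral_cong_AE) auto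
  moreover have "(ln \<sigma> + L) /\<^sub>R \<bar>\<sigma>\<bar> = (ln \<sigma> + L) / \<sigma>"
    using \<sigma> by (simp add: field_simps)
  ultimately have "has_bochner_integral lborel (\<lambda>w. normal_density \<mu> \<sigma> w * ln \<bar>w\<bar>) (ln \<sigma> + L)"
    using \<sigma> by (subst lborel_has_bochner_integral_real_affine_iff[of \<sigma> _ _ 0]) simp_all
  then show ?thesis by (simp only: L_def)
qed

section \<open>Digamma series, Kummer's function and Dawson's integral\<close>

text \<open>Each step psi(x+1) - psi(x) = 1/x is at most 2 for x >= 1/2. This crude growth is enough
  against the factorial.\<close>

lemma Digamma_half_bound: "\<bar>Digamma (1 / 2 + real k)\<bar> \<le> \<bar>Digamma (1/2 :: real)\<bar> + 2 * real k"
proof (induction k)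
  case (Suc k)
  have eq: "Digamma (1/2 + real (Suc k)) = Digamma (1/2 + real k) + 1 / (1/2 + real k)"
    using Digamma_plus1[of "1/2 + real k"] by (simp add: add_ac)
  have "\<bar>1 / (1/2 + real k)\<bar> \<le> 2" by (simp add: divide_simps)
  with Suc show ?case
    unfolding eq using abs_triangle_ineq[of "Digamma (1/2 + real k)" "1 / (1/2 + real k)"] by simp
qed simp

text \<open>Absolute convergence serves the Cauchy product with the series of exp(-u). Since k <=
  2^k, an exponential series at 2 |u| dominates.\<close>

lemma summable_Digamma_series:
  fixes u :: real
  shows "summable (\<lambda>k. norm (Digamma (1 / 2 + real k) / fact k * u ^ k))"
proof (rule summable_comparison_test')
  define D where "D = \<bar>Digamma (1/2 :: real)\<bar> + 2"
  have "summable (\<lambda>k. D * (inverse (fact k) * (2 * \<bar>u\<bar>) ^ k))"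
    by (intro summable_mult summable_exp)
  then show "summable (\<lambda>k. D * (inverse (fact k) * (2 * \<bar>u\<bar>) ^ k))" .
  fix k :: nat
  have k: "real k \<le> 2 ^ k" using of_nat_less_two_power[of k, where 'a=real] by simp
  have "\<bar>Digamma (1 / 2 + real k)\<bar> \<le> \<bar>Digamma (1/2 :: real)\<bar> * 2 ^ k + 2 * 2 ^ k"
  proof -
    have "\<bar>Digamma (1/2 :: real)\<bar> * 1 \<le> \<bar>Digamma (1/2 :: real)\<bar> * 2 ^ k"
      by (intro mult_left_mono) auto
    then show ?thesis using Digamma_half_bound[of k] k by linarith
  qed
  then have "\<bar>Digamma (1 / 2 + real k)\<bar> \<le> D * 2 ^ k" by (simp add: D_def algebra_simps)
  then have "\<bar>Digamma (1 / 2 + real k)\<bar> * (\<bar>u\<bar> ^ k / fact k) \<le> D * 2 ^ k * (\<bar>u\<bar> ^ k / fact k)"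
    by (intro mult_right_mono) auto
  then show "norm (norm (Digamma (1 / 2 + real k) / fact k * u ^ k)) \<le> D * (inverse (fact k) * (2 * \<bar>u\<bar>) ^ k)"
    by (simp add: abs_mult power_abs power_mult_distrib field_simps)
qed

section \<open>Forward differences of the digamma function\<close>

lemma alternating_binomial_sum_Suc:
  fixes f :: "real \<Rightarrow> real"
  shows "(\<Sum>i\<le>Suc n. (-1) ^ i * real (Suc n choose i) * f (x + real i)) =
    (\<Sum>i\<le>n. (-1) ^ i * real (n choose i) * f (x + real i))
    - (\<Sum>i\<le>n. (-1) ^ i * real (n choose i) * f (x + 1 + real i))"
proof -
  \<comment> \<open>Pascal's rule after splitting off the term i = 0. When the first two pieces are
    rejoined, the top index carries the coefficient \<open>n choose Suc n\<close>, which is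
    0.\<close>
  have "(\<Sum>i\<le>Suc n. (-1) ^ i * real (Suc n choose i) * f (x + real i)) =
    f x + (\<Sum>i\<le>n. (-1) ^ Suc i * real (n choose Suc i) * f (x + real (Suc i)))
        + (\<Sum>i\<le>n. (-1) ^ Suc i * real (n choose i) * f (x + real (Suc i)))"
    by (subst sum.atMost_Suc_shift) (simp add: sum.distrib[symmetric] algebra_simps)
  also have "f x + (\<Sum>i\<le>n. (-1) ^ Suc i * real (n choose Suc i) * f (x + real (Suc i)))
     = (\<Sum>i\<le>Suc n. (-1) ^ i * real (n choose i) * f (x + real i))"
    by (simp add: sum.atMost_Suc_shift del: sum.atMost_Suc)
  finally show ?thesis by (simp add: sum_negf add_ac)
qed

text \<open>The first difference is 1/x up to sign, and each further one compares x with x + 1,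
  using 1/x - 1/(x+n+1) = (n+1)/(x (x+n+1)). The order starts at 1, as order 0 gives psi
  itself.\<close>

lemma Digamma_forward_difference:
  fixes x :: real
  assumes "x > 0"
  shows "(\<Sum>i\<le>Suc n. (-1) ^ i * real (Suc n choose i) * Digamma (x + real i))
    = - (fact n / pochhammer x (Suc n))"
  using assms
proof (induction n arbitrary: x)
  case 0
  then show ?case using Digamma_plus1[of x] by simp
next
  case (Suc n)
  have pos: "pochhammer (x + 1) n > 0" using Suc.prems by (intro pochhammer_pos) simp
  have e1: "pochhammer x (Suc n) = x * pochhammer (x + 1) n" by (rule pochhammer_rec)
  have e2: "pochhammer (x+1) (Suc n) = pochhammer (x + 1) n * (x + 1 + real n)"
    by (rule pochhammer_Suc)
  have e3: "pochhammer x (Suc (Suc n)) = x * (pochhammer (x + 1) n * (x + 1 + real n))"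
    by (subst pochhammer_rec) (simp add: e2)
  have "(\<Sum>i\<le>Suc (Suc n). (-1) ^ i * real (Suc (Suc n) choose i) * Digamma (x + real i))
    = - (fact n / pochhammer x (Suc n)) + fact n / pochhammer (x + 1) (Suc n)"
    unfolding alternating_binomial_sum_Suc[of "Suc n"] Suc.IH[OF Suc.prems]
    using Suc.IH[of "x + 1"] Suc.prems by simp
  also have "\<dots> = - (fact (Suc n) / pochhammer x (Suc (Suc n)))"
    unfolding e1 e2 e3 using Suc.prems pos by (simp add: divide_simps) (simp add: algebra_simps)
  finally show ?case .
qed

section \<open>The a-derivative of Kummer's function at a = 0\<close>

lemma pochhammer_half_ge: "fact n \<le> 2 * pochhammer (1/2 :: real) (Suc n)"
proof (induction n)
  case (Suc n)
  \<comment> \<open>The new factors compare as n + 1 <= n + 3/2; the constant 2 makes up for the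
    initial factor 1/2.\<close>
  have "fact (Suc n) \<le> (1/2 + real (Suc n)) * fact n" by (simp add: algebra_simps)
  also have "\<dots> \<le> (1/2 + real (Suc n)) * (2 * pochhammer (1/2 :: real) (Suc n))"
    using Suc by (intro mult_left_mono) auto
  also have "\<dots> = 2 * pochhammer (1/2 :: real) (Suc (Suc n))"
    by (subst (2) pochhammer_Suc) (simp add: mult_ac)
  finally show ?case .
qed simp

text \<open>For n >= 1, (a)_n = a (a+1)_(n-1), so M = 1 + a N(a) near 0. The difference quotient at
  0 is then N itself, and continuity of N, a locally uniform limit of polynomials in a, gives the
  derivative N(0).\<close>

lemma kummer_M_derivative:
  fixes z :: real
  shows "((\<lambda>a. kummer_M a (1 / 2) z) has_field_derivative
     (\<Sum>n. fact n / pochhammer (1/2) (Suc n) * (z ^ Suc n / fact (Suc n)))) (at 0)"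
proof -
  define c where "c = (\<lambda>n. z ^ Suc n / fact (Suc n) / pochhammer (1/2 :: real) (Suc n))"
  define N where "N = (\<lambda>a. \<Sum>n. pochhammer (a + 1) n * c n)"
  have pos: "pochhammer (1/2 :: real) (Suc n) > 0" for n by (intro pochhammer_pos) simp
  have sB: "summable (\<lambda>n. 2 * \<bar>z\<bar> * (inverse (fact n) * \<bar>z\<bar> ^ n))"
    by (intro summable_mult summable_exp)
  have bound: "norm (pochhammer (a + 1) n * c n) \<le> 2 * \<bar>z\<bar> * (inverse (fact n) * \<bar>z\<bar> ^ n)"
    if a: "a \<in> {-1..1}" for a n
  proof -
    \<comment> \<open>For a in [-1,1] each factor a + 1 + i lies in [0, 2 + i]; the resulting (n+1)!
      cancels the factorial inside c.\<close>
    have "\<bar>pochhammer (a + 1) n\<bar> \<le> pochhammer 2 n"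
      using a unfolding pochhammer_prod abs_prod by (intro prod_mono) auto
    also have "\<dots> = fact (Suc n)"
      using pochhammer_rec[of "1::real" n] by (simp add: pochhammer_fact[symmetric] del: fact_Suc)
    finally have 1: "\<bar>pochhammer (a + 1) n\<bar> \<le> fact (Suc n)" .
    have "norm (pochhammer (a + 1) n * c n) = \<bar>pochhammer (a + 1) n\<bar> * \<bar>c n\<bar>"
      by (simp add: abs_mult)
    also have "\<dots> \<le> fact (Suc n) * \<bar>c n\<bar>"
      using 1 by (intro mult_right_mono) auto
    also have "\<dots> = \<bar>z\<bar> ^ Suc n / pochhammer (1/2 :: real) (Suc n)"
      using pos[of n] by (simp add: c_def abs_mult power_abs del: fact_Suc power_Suc)
    also have "\<dots> \<le> \<bar>z\<bar> ^ Suc n / (fact n / 2)"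
      using pochhammer_half_ge[of n] pos[of n] by (intro divide_left_mono) auto
    also have "\<dots> = 2 * \<bar>z\<bar> * (inverse (fact n) * \<bar>z\<bar> ^ n)" by (simp add: field_simps)
    finally show ?thesis .
  qed
  have summ: "summable (\<lambda>n. pochhammer (a + 1) n * c n)" if "a \<in> {-1..1}" for a
    using summable_comparison_test'[OF sB bound[OF that]] .
  have "uniform_limit {-1..1} (\<lambda>n a. \<Sum>i<n. pochhammer (a + 1) i * c i) N sequentially"
    unfolding N_def by (rule Weierstrass_m_test[OF bound sB])
  then have "continuous_on {-1..1} N"
    by (rule uniform_limit_theorem[rotated])
      (auto intro!: always_eventually continuous_intros simp: pochhammer_prod)
  then have "isCont N 0" by (rule continuous_on_interior) simp
  then have lim: "(N \<longlongrightarrow> N 0) (at 0)" by (simp add: isCont_def)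
  have M_eq: "kummer_M a (1/2) z = 1 + a * N a" if "a \<in> {-1..1}" for a
  proof -
    have "(\<lambda>n. a * (pochhammer (a + 1) n * c n)) sums (a * N a)"
      unfolding N_def using summ[OF that] by (intro sums_mult summable_sums)
    then have "(\<lambda>n. pochhammer a (Suc n) / pochhammer (1/2) (Suc n) * (z ^ Suc n / fact (Suc n))) sums (a * N a)"
      by (simp add: c_def pochhammer_rec[of a] mult_ac del: fact_Suc power_Suc)
    then have "(\<lambda>n. pochhammer a n / pochhammer (1/2) n * (z ^ n / fact n)) sums (a * N a + 1)"
      by (subst (asm) sums_Suc_iff) simp
    then show ?thesis by (simp add: kummer_M_def sums_iff)
  qed
  have "((\<lambda>h. (kummer_M (0 + h) (1/2) z - kummer_M 0 (1/2) z) / h) \<longlongrightarrow> N 0) (at 0)"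
  proof (rule Lim_transform_eventually[OF lim])
    have "eventually (\<lambda>h. h \<in> {-1<..<1::real}) (at 0)"
      by (rule eventually_at_in_open') auto
    then show "\<forall>\<^sub>F h in at 0. N h = (kummer_M (0 + h) (1/2) z - kummer_M 0 (1/2) z) / h"
      using eventually_neq_at_within[of 0 0 UNIV]
      by eventually_elim (simp add: M_eq)
  qed
  moreover have eq: "pochhammer (0 + 1) n * c n = fact n / pochhammer (1/2) (Suc n) * (z ^ Suc n / fact (Suc n))" for n
    by (simp add: c_def pochhammer_fact[symmetric] del: fact_Suc power_Suc)
  ultimately show "((\<lambda>a. kummer_M a (1 / 2) z) has_field_derivative
     (\<Sum>n. fact n / pochhammer (1/2) (Suc n) * (z ^ Suc n / fact (Suc n)))) (at 0)"
    unfolding DERIV_def N_def by (simp only: eq)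
qed

lemma summable_Digamma_series':
  fixes u :: real
  shows "summable (\<lambda>k. u ^ k / fact k * Digamma (1 / 2 + real k))"
  using summable_norm_cancel[OF summable_Digamma_series[of u]] by (simp add: mult_ac)

text \<open>In the Cauchy product with exp(-u), the coefficient of (-u)^k / k! is an alternating
  binomial sum of psi at 1/2. The closed form of these differences matches the Kummer derivative
  term by term, with opposite sign.\<close>

lemma Digamma_series_eq_kummer_M_deriv:
  fixes u :: real
  shows "exp (- u) * (\<Sum>k. u ^ k / fact k * Digamma (1 / 2 + real k)) =
    Digamma (1/2) - deriv (\<lambda>a. kummer_M a (1 / 2) (- u)) 0"
proof -
  define a where "a = (\<lambda>k. Digamma (1 / 2 + real k) / fact k * u ^ k)"
  define b where "b = (\<lambda>k. (- u) ^ k /\<^sub>R fact k)"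
  define T where "T = (\<lambda>n. fact n / pochhammer (1/2) (Suc n) * ((- u) ^ Suc n / fact (Suc n)))"
  have "(\<lambda>k. \<Sum>i\<le>k. a i * b (k - i)) sums ((\<Sum>k. a k) * (\<Sum>k. b k))"
    unfolding a_def b_def
    by (intro Cauchy_product_sums summable_Digamma_series summable_norm_exp)
  moreover have "(\<Sum>k. b k) = exp (- u)" by (simp add: b_def exp_def)
  moreover have "(\<Sum>i\<le>k. a i * b (k - i)) = (- u) ^ k / fact k *
      (\<Sum>i\<le>k. (-1) ^ i * real (k choose i) * Digamma (1/2 + real i))" for k
    unfolding sum_distrib_left
  proof (rule sum.cong)
    fix i assume "i \<in> {..k}"
    then have i: "i \<le> k" by simp
    have p: "(- u) ^ k = (- u) ^ (k - i) * (- u) ^ i" using i by (simp flip: power_add)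
    have q: "u ^ i = (- 1) ^ i * (- u) ^ i" by (simp flip: power_mult_distrib)
    have c: "real (k choose i) = fact k / (fact i * fact (k - i))"
      using i by (rule binomial_fact)
    show "a i * b (k - i) = (- u) ^ k / fact k * ((- 1) ^ i * real (k choose i) * Digamma (1 / 2 + real i))"
      unfolding a_def b_def p q c by (simp add: field_simps)
  qed simp
  ultimately have "(\<lambda>k. (- u) ^ k / fact k *
      (\<Sum>i\<le>k. (-1) ^ i * real (k choose i) * Digamma (1/2 + real i))) sums ((\<Sum>k. a k) * exp (- u))"
    by simp
  \<comment> \<open>Index 0 is split off: it is psi(1/2), and the closed form covers orders from 1
    on.\<close>
  then have "(\<lambda>k. (- u) ^ Suc k / fact (Suc k) *
      (\<Sum>i\<le>Suc k. (-1) ^ i * real (Suc k choose i) * Digamma (1/2 + real i)))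
      sums ((\<Sum>k. a k) * exp (- u) - Digamma (1/2))"
    by (subst sums_Suc_iff) simp
  moreover have "(- u) ^ Suc k / fact (Suc k) *
      (\<Sum>i\<le>Suc k. (-1) ^ i * real (Suc k choose i) * Digamma (1/2 + real i)) = - T k" for k
    by (subst Digamma_forward_difference) (simp_all add: T_def mult_ac del: fact_Suc power_Suc)
  ultimately have "(\<lambda>k. - T k) sums ((\<Sum>k. a k) * exp (- u) - Digamma (1/2))"
    by simp
  then have "(\<Sum>k. T k) = Digamma (1/2) - (\<Sum>k. a k) * exp (- u)"
    using sums_minus by (fastforce simp: sums_iff)
  moreover have "deriv (\<lambda>a. kummer_M a (1 / 2) (- u)) 0 = (\<Sum>k. T k)"
    unfolding T_def by (rule DERIV_imp_deriv[OF kummer_M_derivative])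
  ultimately show ?thesis by (simp add: a_def mult_ac)
qed

section \<open>Dawson's integral through the series 2 M(1/2; 3/2; u)\<close>

definition dawson_series :: "real \<Rightarrow> real" where
  "dawson_series u = (\<Sum>n. 1 / (fact n * (1/2 + real n)) * u ^ n)"

lemma summable_dawson_series:
  fixes u :: real
  shows "summable (\<lambda>n. 1 / (fact n * (1/2 + real n)) * u ^ n)"
proof (rule summable_comparison_test')
  show "summable (\<lambda>n. 2 * (inverse (fact n) * \<bar>u\<bar> ^ n))"
    by (intro summable_mult summable_exp)
  fix n :: nat
  have "norm (1 / (fact n * (1/2 + real n)) * u ^ n) = \<bar>u\<bar> ^ n / (fact n * (1/2 + real n))"
    by (simp add: abs_mult power_abs)
  also have "\<dots> \<le> \<bar>u\<bar> ^ n / (fact n * (1/2))"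
    by (intro divide_left_mono mult_left_mono) auto
  also have "\<dots> = 2 * (inverse (fact n) * \<bar>u\<bar> ^ n)" by (simp add: field_simps)
  finally show "norm (1 / (fact n * (1/2 + real n)) * u ^ n) \<le> 2 * (inverse (fact n) * \<bar>u\<bar> ^ n)" .
qed

text \<open>The differential equation holds coefficientwise: n and 1/2 add up to the factor n + 1/2
  in the denominator, which leaves 1/n!.\<close>

lemma dawson_series_derivative:
  obtains D where "(dawson_series has_field_derivative D) (at u)" "u * D + dawson_series u / 2 = exp u"
proof -
  define c where "c = (\<lambda>n. 1 / (fact n * (1/2 + real n)))"
  define D where "D = (\<Sum>n. diffs c n * u ^ n)"
  have sm: "summable (\<lambda>n. c n * y ^ n)" for y unfolding c_def by (rule summable_dawson_series)
  have "(dawson_series has_field_derivative D) (at u)"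
    using termdiffs_strong_converges_everywhere[OF sm, of u]
    by (simp add: dawson_series_def[abs_def] c_def D_def)
  moreover have "u * D + dawson_series u / 2 = exp u"
  proof -
    have "(\<lambda>n. of_nat n * c n * u ^ (n - Suc 0)) sums D"
      unfolding D_def by (intro diffs_equiv termdiff_converges_all sm)
    then have "(\<lambda>n. u * (real n * c n * u ^ (n - Suc 0))) sums (u * D)"
      by (intro sums_mult) simp
    \<comment> \<open>At n = 0 the exponent \<open>n - Suc 0\<close> is truncated to 0, but the
      factor n vanishes.\<close>
    moreover have "u * (real n * c n * u ^ (n - Suc 0)) = real n * c n * u ^ n" for n
      by (cases n) auto
    ultimately have "(\<lambda>n. real n * c n * u ^ n) sums (u * D)" by simp
    moreover have "(\<lambda>n. c n * u ^ n / 2) sums (dawson_series u / 2)"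
      using summable_sums[OF sm[of u]] by (intro sums_divide) (simp add: dawson_series_def c_def)
    ultimately have "(\<lambda>n. real n * c n * u ^ n + c n * u ^ n / 2) sums (u * D + dawson_series u / 2)"
      by (rule sums_add)
    moreover have "real n * c n * u ^ n + c n * u ^ n / 2 = u ^ n /\<^sub>R fact n" for n
    proof -
      have "real n * c n * u ^ n + c n * u ^ n / 2 = (1/2 + real n) * c n * u ^ n"
        by (simp add: algebra_simps)
      also have "(1/2 + real n) * c n = 1 / fact n"
        unfolding c_def by (simp add: divide_simps add_eq_0_iff)
      finally show ?thesis by (simp add: field_simps)
    qed
    ultimately show ?thesis using exp_converges[of u] sums_unique2 by fastforce
  qed
  ultimately show thesis by (rule that)
qed

lemma continuous_on_dawson_series: "continuous_on A dawson_series"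
proof (intro continuous_at_imp_continuous_on ballI)
  fix u show "isCont dawson_series u"
    by (rule dawson_series_derivative[of u]) (rule DERIV_isCont)
qed

text \<open>By the differential equation, t \<open>dawson_series\<close>(t^2) / 2 is an
  antiderivative of exp(t^2), and it vanishes at 0.\<close>

lemma dawson_eq_series:
  assumes "x \<ge> 0"
  shows "dawson x = exp (- x\<^sup>2) * (x * dawson_series (x\<^sup>2) / 2)"
proof -
  have "(LBINT t=ereal 0..ereal x. exp (t\<^sup>2)) = x * dawson_series (x\<^sup>2) / 2 - 0 * dawson_series (0\<^sup>2) / 2"
  proof (rule interval_integral_FTC_finite)
    show "continuous_on {min 0 x..max 0 x} (\<lambda>t. exp (t\<^sup>2))" by (intro continuous_intros)
    fix t :: real
    obtain D where D: "(dawson_series has_field_derivative D) (at (t\<^sup>2))"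
      "t\<^sup>2 * D + dawson_series (t\<^sup>2) / 2 = exp (t\<^sup>2)"
      by (rule dawson_series_derivative)
    have "((\<lambda>t. dawson_series (t\<^sup>2)) has_field_derivative D * (2 * t)) (at t)"
      by (rule DERIV_chain2[where g = "\<lambda>t. t\<^sup>2", OF D(1)]) (auto intro!: derivative_eq_intros)
    then have "((\<lambda>t. t * dawson_series (t\<^sup>2) / 2) has_field_derivative exp (t\<^sup>2)) (at t)"
      using D(2) by (auto intro!: derivative_eq_intros simp: power2_eq_square algebra_simps)
    then show "((\<lambda>t. t * dawson_series (t\<^sup>2) / 2) has_vector_derivative exp (t\<^sup>2)) (at t within {min 0 x..max 0 x})"
      by (simp add: has_real_derivative_iff_has_vector_derivative has_vector_derivative_at_within)
  qed
  then show ?thesis by (simp add: dawson_def zero_ereal_def)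
qed

text \<open>With the factor exp(-u), differentiation replaces the coefficients c_n by (n+1) c_(n+1)
  - c_n, a single difference of psi over n!.\<close>

lemma Digamma_series_derivative:
  fixes u :: real
  shows "((\<lambda>u. exp (- u) * (\<Sum>k. u ^ k / fact k * Digamma (1 / 2 + real k)))
    has_field_derivative exp (- u) * dawson_series u) (at u)"
proof -
  define c where "c = (\<lambda>k. Digamma (1 / 2 + real k) / fact k)"
  have sm: "summable (\<lambda>n. c n * y ^ n)" for y
    unfolding c_def by (rule summable_norm_cancel[OF summable_Digamma_series])
  have "diffs c n * u ^ n - c n * u ^ n = 1 / (fact n * (1/2 + real n)) * u ^ n" for n
  proof -
    have "Digamma (1/2 + real (Suc n)) = Digamma (1/2 + real n) + 1 / (1/2 + real n)"
      using Digamma_plus1[of "1/2 + real n"] by (simp add: add_ac)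
    moreover have "diffs c n = Digamma (1/2 + real (Suc n)) / fact n"
      unfolding diffs_def c_def by (simp add: divide_simps del: of_nat_Suc)
    ultimately have "diffs c n - c n = 1 / (fact n * (1/2 + real n))"
      by (simp add: c_def add_divide_distrib mult_ac)
    then show ?thesis by (simp add: left_diff_distrib[symmetric])
  qed
  then have "(\<Sum>n. diffs c n * u ^ n) - (\<Sum>n. c n * u ^ n) = dawson_series u"
    unfolding dawson_series_def
    by (subst suminf_diff) (auto intro: sm termdiff_converges_all)
  moreover have "((\<lambda>u. exp (- u) * (\<Sum>n. c n * u ^ n)) has_field_derivative
      exp (- u) * ((\<Sum>n. diffs c n * u ^ n) - (\<Sum>n. c n * u ^ n))) (at u)"
    by (rule derivative_eq_intros termdiffs_strong_converges_everywhere[OF sm] refl | simp add: algebra_simps)+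
  ultimately show ?thesis by (simp add: c_def mult_ac)
qed

section \<open>The pseudo KL divergence\<close>

text \<open>The negative entropy of the normal law: ln q is a constant minus (w - \<mu>)^2 / (2 v),
  and the second central moment v turns the quadratic part into -1/2.\<close>

lemma has_bochner_integral_ln_normal_density:
  assumes v: "v > 0"
  shows "has_bochner_integral (density lborel (normal_density \<mu> (sqrt v)))
    (\<lambda>w. ln (normal_density \<mu> (sqrt v) w)) (- (1/2) * ln (2 * pi * v) - 1/2)"
proof (rule has_bochner_integral_density)
  let ?q = "normal_density \<mu> (sqrt v)"
  have ln_q: "ln (?q w) = - (1/2) * ln (2 * pi * v) - 1 / (2 * v) * (w - \<mu>)\<^sup>2" for w
    using v by (simp add: normal_density_def ln_mult ln_div ln_sqrt)
  have "has_bochner_integral lborel ?q 1"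
    using v by (simp add: has_bochner_integral_iff)
  moreover have "has_bochner_integral lborel (\<lambda>w. ?q w * (w - \<mu>)\<^sup>2) v"
    using normal_moment_even[of "sqrt v" \<mu> 1] v by simp
  ultimately have "has_bochner_integral lborel
      (\<lambda>w. - (1/2) * ln (2 * pi * v) * ?q w - 1 / (2 * v) * (?q w * (w - \<mu>)\<^sup>2))
      (- (1/2) * ln (2 * pi * v) * 1 - 1 / (2 * v) * v)"
    by (intro has_bochner_integral_diff has_bochner_integral_mult_right)
  moreover have "?q w *\<^sub>R ln (?q w) = - (1/2) * ln (2 * pi * v) * ?q w - 1 / (2 * v) * (?q w * (w - \<mu>)\<^sup>2)" for w
    unfolding ln_q by (simp add: algebra_simps)
  ultimately show "has_bochner_integral lborel (\<lambda>w. ?q w *\<^sub>R ln (?q w)) (- (1/2) * ln (2 * pi * v) - 1/2)"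
    using v by simp
qed auto

text \<open>Here ln p = ln C - ln |w| almost everywhere. The weights exp(-u) u^k / k! sum to 1, so
  ln 2 leaves the series as a single constant.\<close>

lemma has_bochner_integral_ln_log_uniform_density:
  fixes C \<mu> v :: real
  assumes v: "v > 0" and C: "C > 0"
  defines "u \<equiv> u_of \<mu> v"
  shows "has_bochner_integral (density lborel (normal_density \<mu> (sqrt v)))
    (\<lambda>w. ln (log_uniform_density C w))
    (ln C - (ln v + ln 2 + exp (- u) * (\<Sum>k. u ^ k / fact k * Digamma (1 / 2 + real k))) / 2)"
proof (rule has_bochner_integral_density)
  let ?q = "normal_density \<mu> (sqrt v)"
  let ?S = "\<Sum>k. u ^ k / fact k * Digamma (1 / 2 + real k)"
  have exp_sums: "(\<lambda>k. u ^ k / fact k) sums exp u"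
    using exp_converges[of u] by (simp add: field_simps)
  have "(\<lambda>k. u ^ k / fact k * ln 2 + u ^ k / fact k * Digamma (1 / 2 + real k)) sums (exp u * ln 2 + ?S)"
    by (intro sums_add sums_mult2 exp_sums summable_sums summable_Digamma_series')
  then have "(\<Sum>k. u ^ k / fact k * (ln 2 + Digamma (1 / 2 + real k))) = exp u * ln 2 + ?S"
    by (simp add: distrib_left sums_iff)
  then have "exp (- u) * (\<Sum>k. u ^ k / fact k * (ln 2 + Digamma (1 / 2 + real k))) = ln 2 + exp (- u) * ?S"
    by (simp add: distrib_left mult.assoc[symmetric] exp_minus_inverse mult.commute[of "exp (- u)"])
  then have "has_bochner_integral lborel (\<lambda>w. ?q w * ln \<bar>w\<bar>) (ln v / 2 + (ln 2 + exp (- u) * ?S) / 2)"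
    using has_bochner_integral_log_normal[of "sqrt v" \<mu>] v by (simp add: u_def u_of_def ln_sqrt)
  moreover have "has_bochner_integral lborel ?q 1"
    using v by (simp add: has_bochner_integral_iff)
  ultimately have "has_bochner_integral lborel (\<lambda>w. ln C * ?q w - ?q w * ln \<bar>w\<bar>)
      (ln C * 1 - (ln v / 2 + (ln 2 + exp (- u) * ?S) / 2))"
    by (intro has_bochner_integral_diff has_bochner_integral_mult_right)
  \<comment> \<open>At w = 0 the density takes the default value 0 and the identity may fail; one
    point is a null set.\<close>
  moreover have "AE w in lborel. ln C * ?q w - ?q w * ln \<bar>w\<bar> = ?q w *\<^sub>R ln (log_uniform_density C w)"
    using AE_lborel_singleton[of "0::real"]
  proof eventually_elim
    case (elim w)
    with C show ?case by (simp add: log_uniform_density_def ln_div algebra_simps)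
  qed
  ultimately have "has_bochner_integral lborel (\<lambda>w. ?q w *\<^sub>R ln (log_uniform_density C w))
      (ln C * 1 - (ln v / 2 + (ln 2 + exp (- u) * ?S) / 2))"
    by (subst (asm) has_bochner_integral_cong_AE) (auto simp: log_uniform_density_def)
  moreover have "ln C * 1 - (ln v / 2 + (ln 2 + exp (- u) * ?S) / 2) = ln C - (ln v + ln 2 + exp (- u) * ?S) / 2"
    by (simp add: field_simps)
  ultimately show "has_bochner_integral lborel (\<lambda>w. ?q w *\<^sub>R ln (log_uniform_density C w))
      (ln C - (ln v + ln 2 + exp (- u) * ?S) / 2)"
    by (simp only:)
qed (auto simp: log_uniform_density_def)

text \<open>The entropy term contributes -(ln v)/2 and the scale in E[ln |w|] contributes +(ln v)/2;
  they cancel, and only u remains.\<close>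

lemma KL_normal_eq_Digamma_series:
  fixes C \<mu> v :: real
  assumes v: "v > 0" and C: "C > 0"
  defines "u \<equiv> u_of \<mu> v"
  shows "has_pseudo_KL (normal_density \<mu> (sqrt v)) (log_uniform_density C)"
    and "KL_normal C \<mu> v = - (1 / 2) * ln (2 * pi * exp 1) - ln C
            + 1 / 2 * (ln 2 + exp (- u) * (\<Sum>k. u ^ k / fact k * Digamma (1 / 2 + real k)))"
  using has_bochner_integral_ln_normal_density[OF v, of \<mu>]
    has_bochner_integral_ln_log_uniform_density[OF v C, of \<mu>] v
  by (simp_all add: has_pseudo_KL_def KL_normal_def pseudo_KL_def has_bochner_integral_iff u_def
      ln_mult field_simps)

text \<open>Every u >= 0 equals \<open>u_of (sqrt (2 * u)) 1\<close>, so F and G are determined on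
  the closed half-line and the existential form does describe KL as a function of u. The conjuncts
  on summability and differentiability ensure that \<open>suminf\<close> and \<open>deriv\<close>
  are not default values.\<close>

theorem mainTheorem2:
  fixes C :: real
  assumes "C > 0"
  shows
    "(\<forall>\<mu> v :: real. v > 0 \<longrightarrow>
        (let u = u_of \<mu> v in
          has_pseudo_KL (normal_density \<mu> (sqrt v)) (log_uniform_density C) \<and>
          summable (\<lambda>k. u ^ k / fact k * Digamma (1 / 2 + real k)) \<and>
          KL_normal C \<mu> v =
            - (1 / 2) * ln (2 * pi * exp 1) - ln C
            + 1 / 2 * (ln 2 + exp (- u) * (\<Sum>k. u ^ k / fact k * Digamma (1 / 2 + real k))) \<and>
          (\<lambda>a. kummer_M a (1 / 2) (- u)) field_differentiable at 0 \<and>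
          KL_normal C \<mu> v =
            - (1 / 2) * ln (pi * exp 1) - ln C
            - 1 / 2 * (deriv (\<lambda>a. kummer_M a (1 / 2) (- u)) 0 + euler_mascheroni + 2 * ln 2)))
     \<and>
     (\<exists>F G :: real \<Rightarrow> real.
        (\<forall>\<mu> v. v > 0 \<longrightarrow> KL_normal C \<mu> v = F (u_of \<mu> v)) \<and>
        (\<forall>u\<ge>0. (F has_real_derivative G u) (at u within {0..})) \<and>
        (\<forall>u\<ge>0. G u = (if u = 0 then 1 else dawson (sqrt u) / sqrt u)) \<and>
        continuous_on {0..} G \<and>
        (\<forall>\<mu> v. v > 0 \<longrightarrow>
          ((\<lambda>m. KL_normal C m v) has_real_derivative
             G (u_of \<mu> v) * deriv (\<lambda>m. u_of m v) \<mu>) (at \<mu>) \<and>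
          ((\<lambda>s. KL_normal C \<mu> s) has_real_derivative
             G (u_of \<mu> v) * deriv (\<lambda>s. u_of \<mu> s) v) (at v)))"
proof (rule conjI, goal_cases)
  case 1
  have "KL_normal C \<mu> v = - (1 / 2) * ln (pi * exp 1) - ln C
      - 1 / 2 * (deriv (\<lambda>a. kummer_M a (1 / 2) (- u_of \<mu> v)) 0 + euler_mascheroni + 2 * ln 2)"
    if v: "v > 0" for \<mu> v :: real
    \<comment> \<open>Uses psi(1/2) = - \<gamma> - 2 ln 2; the free (ln 2)/2 is absorbed into the
      change from 2 pi e to pi e.\<close>
    unfolding KL_normal_eq_Digamma_series(2)[OF v assms] Digamma_series_eq_kummer_M_deriv Digamma_one_half
    by (simp add: ln_mult field_simps)
  moreover have "(\<lambda>a. kummer_M a (1 / 2) z) field_differentiable at 0" for z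
    using kummer_M_derivative by (auto simp: field_differentiable_def)
  ultimately show ?case
    unfolding Let_def
    by (intro allI impI conjI KL_normal_eq_Digamma_series assms summable_Digamma_series')
next
  case 2
  define F where "F = (\<lambda>u. - (1 / 2) * ln (2 * pi * exp 1) - ln C
            + 1 / 2 * (ln 2 + exp (- u) * (\<Sum>k. u ^ k / fact k * Digamma (1 / 2 + real k))))"
  \<comment> \<open>The Dawson quotient has a removable singularity at 0; this form continues it,
    with value \<open>dawson_series 0 / 2\<close> = 1.\<close>
  define G where "G = (\<lambda>u. exp (- u) * dawson_series u / 2)"
  have KL: "KL_normal C \<mu> v = F (u_of \<mu> v)" if "v > 0" for \<mu> v
    unfolding F_def by (rule KL_normal_eq_Digamma_series(2)[OF that assms])
  \<comment> \<open>The derivative is two-sided at every real u, so the chain rule also applies at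
    \<mu> = 0, where u is the endpoint 0.\<close>
  have F: "(F has_real_derivative G u) (at u)" for u
    unfolding F_def G_def
    by (rule derivative_eq_intros Digamma_series_derivative refl | simp)+
  have G: "G u = (if u = 0 then 1 else dawson (sqrt u) / sqrt u)" if "u \<ge> 0" for u
  proof (cases "u = 0")
    case True
    have "dawson_series 0 = 2" unfolding dawson_series_def by (subst powser_zero) simp
    with True show ?thesis by (simp add: G_def)
  next
    case False
    with that show ?thesis by (simp add: G_def dawson_eq_series)
  qed
  have cont: "continuous_on {0..} G"
    unfolding G_def by (intro continuous_intros continuous_on_dawson_series) auto
  have deriv_\<mu>: "((\<lambda>m. KL_normal C m v) has_real_derivative
      G (u_of \<mu> v) * deriv (\<lambda>m. u_of m v) \<mu>) (at \<mu>)" if v: "v > 0" for \<mu> v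
  proof -
    have "((\<lambda>m. u_of m v) has_real_derivative \<mu> / v) (at \<mu>)"
      unfolding u_of_def using v by (auto intro!: derivative_eq_intros)
    then have "((\<lambda>m. u_of m v) has_real_derivative deriv (\<lambda>m. u_of m v) \<mu>) (at \<mu>)"
      by (simp add: DERIV_imp_deriv)
    then show ?thesis
      unfolding KL[OF v] by (rule DERIV_chain2[OF F])
  qed
  have deriv_v: "((\<lambda>s. KL_normal C \<mu> s) has_real_derivative
      G (u_of \<mu> v) * deriv (\<lambda>s. u_of \<mu> s) v) (at v)" if v: "v > 0" for \<mu> v
  proof -
    have "((\<lambda>s. u_of \<mu> s) has_real_derivative - \<mu>\<^sup>2 / (2 * v\<^sup>2)) (at v)"
      unfolding u_of_def using v
      by (auto intro!: derivative_eq_intros simp: power2_eq_square field_simps)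
    then have "((\<lambda>s. u_of \<mu> s) has_real_derivative deriv (\<lambda>s. u_of \<mu> s) v) (at v)"
      by (simp add: DERIV_imp_deriv)
    then have "((\<lambda>s. F (u_of \<mu> s)) has_real_derivative G (u_of \<mu> v) * deriv (\<lambda>s. u_of \<mu> s) v) (at v)"
      by (rule DERIV_chain2[OF F])
    \<comment> \<open>KL is identified with F(u) only for positive variance, so the derivative is
      transferred on that open set.\<close>
    then show ?thesis
      by (rule has_field_derivative_transform_within_open[where S = "{0<..}"]) (use v KL in auto)
  qed
  show ?case
    using KL F G cont deriv_\<mu> deriv_v
    by (intro exI[of _ F] exI[of _ G]) (blast intro: has_field_derivative_at_within)
qed

end
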